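(* Let $d\ge 0$, $n\ge 2$ and $0\le k\le d$ be integers and let $p\in[0,1]$. If each open $i$-cube of $\mathcal{L}$ ($i=0,1,\dots,d$) is included in $C$ independently with probability $p^i$, then the expected value and variance of $\mu_k(C)$, normalized by volume, are $$\frac{1}{n^d}\mathbb{E}(\mu_k(C))=\binom{d}{k}p^k(1-p)^{d-k},$$ $$\frac{1}{n^d}\mathrm{Var}(\mu_k(C))=\sum_{i=k}^d\binom{d}{i}\binom{i}{k}^2\left(p^i-p^{2i}\right).$$
   Context: The lattice $\mathcal{L}$ is the $d$-dimensional torus $(\mathbb{R}/n\mathbb{Z})^d$ subdivided into $n^d$ unit $d$-cubes. An open $i$-cube of $\mathcal{L}$ ($0\le i\le d$) is a product of $d$ factors, each of which is either a point $\{a\}$ or an open unit interval $(a,a+1)$ with $a\in\mathbb{Z}/n\mathbb{Z}$, with exactly $i$ factors being intervals; $\mathcal{L}$ is the disjoint union of its open cubes. Intrinsic volumes: an open $i$-cube has $k$-th intrinsic volume $(-1)^{i-k}\binom{i}{k}$ (which is $0$ if $k>i$), and if $C$ is a union of open cubes of $\mathcal{L}$ then $\mu_k(C)$ is the sum of the $k$-th intrinsic volumes of the open cubes contained in $C$. In this "independent faces model", $C$ is the union of the included open cubes; it need not be closed (faces of an included cube are not automatically included). Convention: $p^0=1$. *)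

theory Defs
  imports "HOL-Probability.Probability"
begin

text \<open>Points of the circle \<open>\<real>/n\<int>\<close> are equivalence classes of the following relation;
  points of the torus \<open>(\<real>/n\<int>)\<^sup>d\<close> are extensional functions from \<open>{..<d}\<close> to such classes.\<close>

definition circle_rel :: "nat \<Rightarrow> (real \<times> real) set" where
  "circle_rel n = {(x, y). \<exists>m::int. x - y = of_int m * of_nat n}"

definition circle :: "nat \<Rightarrow> real set set" where
  "circle n = UNIV // circle_rel n"

definition torus :: "nat \<Rightarrow> nat \<Rightarrow> (nat \<Rightarrow> real set) set" where
  "torus n d = (\<Pi>\<^sub>E j\<in>{..<d}. circle n)"

definition to_circle :: "nat \<Rightarrow> real \<Rightarrow> real set" where
  "to_circle n x = circle_rel n `` {x}"

text \<open>The elements \<open>a\<close> of \<open>\<int>/n\<int>\<close> are given by integer representatives; congruent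
  representatives give the same subset of the circle.\<close>

definition point_factors :: "nat \<Rightarrow> real set set set" where
  "point_factors n = {to_circle n ` {of_int a} | a::int. True}"

definition interval_factors :: "nat \<Rightarrow> real set set set" where
  "interval_factors n = {to_circle n ` {of_int a <..< of_int a + 1} | a::int. True}"

definition open_cubes :: "nat \<Rightarrow> nat \<Rightarrow> nat \<Rightarrow> (nat \<Rightarrow> real set) set set" where
  "open_cubes n d i =
     {PiE {..<d} F | F.
        (\<forall>j<d. F j \<in> point_factors n \<union> interval_factors n) \<and>
        card {j. j < d \<and> F j \<in> interval_factors n} = i}"

definition lattice_cubes :: "nat \<Rightarrow> nat \<Rightarrow> (nat \<Rightarrow> real set) set set" where
  "lattice_cubes n d = (\<Union>i\<le>d. open_cubes n d i)"

text \<open>For \<open>k > i\<close> the subtraction truncates, but the binomial coefficient vanishes.\<close>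

definition cube_intrinsic_volume :: "nat \<Rightarrow> nat \<Rightarrow> real" where
  "cube_intrinsic_volume k i = (-1) ^ (i - k) * of_nat (i choose k)"

definition intrinsic_volume :: "nat \<Rightarrow> nat \<Rightarrow> nat \<Rightarrow> (nat \<Rightarrow> real set) set \<Rightarrow> real" where
  "intrinsic_volume n d k C =
     (\<Sum>i\<le>d. \<Sum>c | c \<in> open_cubes n d i \<and> c \<subseteq> C. cube_intrinsic_volume k i)"

lemma lattice_cubes_subset_torus:
  assumes "c \<in> lattice_cubes n d"
  shows "c \<subseteq> torus n d"
proof -
  have "F \<subseteq> circle n" if "F \<in> point_factors n \<union> interval_factors n" for F
    using that
    by (auto simp: point_factors_def interval_factors_def circle_def to_circle_def quotient_def)
  then show ?thesis
    using assms unfolding lattice_cubes_def open_cubes_def torus_def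
    by (fastforce intro!: PiE_mono)
qed

end

theory Submission
  imports Defs
begin

text \<open>The open cubes partition the torus into nonempty pieces, so an open cube lies in a union of
  open cubes only if it is one of them. Hence \<open>\<mu>\<^sub>k(C)\<close> is a weighted sum of the indicators of the
  independent inclusion events, with \<open>\<binom>{d}{i} n\<^sup>d\<close> of them in dimension \<open>i\<close>. The expectation is then a
  binomial expansion, and the variance is additive because the indicators are uncorrelated.\<close>

section \<open>Factors of the cubes\<close>

text \<open>Both kinds of factor share one definition, with \<open>b\<close> marking intervals, so
  that a single lemma compares points with points, intervals with intervals, and points with
  intervals.\<close>

definition cell :: "nat \<Rightarrow> bool \<Rightarrow> int \<Rightarrow> real set set" where
  "cell n b a = to_circle n ` (if b then {of_int a <..< of_int a + 1} else {of_int a})"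

lemma to_circle_eq_iff:
  "to_circle n x = to_circle n y \<longleftrightarrow> (\<exists>m::int. x - y = of_int m * of_nat n)"
proof -
  have "equiv UNIV (circle_rel n)"
  proof (intro equivI refl_onI symI transI)
    fix x y z assume "(x, y) \<in> circle_rel n" "(y, z) \<in> circle_rel n"
    then obtain m m' :: int where "x - y = of_int m * of_nat n" "y - z = of_int m' * of_nat n"
      by (auto simp: circle_rel_def)
    then have "x - z = of_int (m + m') * of_nat n"
      by (simp add: algebra_simps)
    then show "(x, z) \<in> circle_rel n"
      unfolding circle_rel_def by blast
  next
    fix x y assume "(x, y) \<in> circle_rel n"
    then obtain m :: int where "x - y = of_int m * of_nat n"
      by (auto simp: circle_rel_def)
    then have "y - x = of_int (- m) * of_nat n"
      by (simp add: algebra_simps)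
    then show "(y, x) \<in> circle_rel n"
      unfolding circle_rel_def by blast
  qed (auto simp: circle_rel_def intro: exI[of _ 0])
  then show ?thesis
    unfolding to_circle_def by (subst eq_equiv_class_iff) (auto simp: circle_rel_def)
qed

lemma cell_nonempty: "cell n b a \<noteq> {}"
  by (auto simp: cell_def)

text \<open>Translating by a multiple of \<open>n\<close> changes no class in the circle, so every
  cell has a representative between 0 and \<open>n - 1\<close>.\<close>

lemma cell_mod: "cell n b (a mod int n) = cell n b a"
proof -
  \<comment> \<open>\<open>s\<close> is the whole number of turns separating \<open>a\<close> from
    its residue.\<close>
  define s :: real where "s = of_int (a div int n) * of_nat n"
  have a: "of_int a = of_int (a mod int n) + s"
    unfolding s_def by (metis add.commute div_mult_mod_eq of_int_add of_int_mult of_int_of_nat_eq)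
  have shift: "to_circle n x = to_circle n (x + s)" for x
    unfolding to_circle_eq_iff s_def by (intro exI[of _ "- (a div int n)"]) simp
  have "(if b then {of_int a <..< of_int a + 1} else {of_int a}) =
      (\<lambda>x. x + s) ` (if b then {of_int (a mod int n) <..< of_int (a mod int n) + 1}
        else {of_int (a mod int n)})"
    using a by (auto simp: image_iff intro!: bexI[of _ "_ - s"])
  then show ?thesis
    unfolding cell_def by (simp only: image_image shift[symmetric])
qed

text \<open>Two reals over a common circle point differ by a multiple of \<open>n\<close>, hence so
  do their floors; reduced floors then coincide. This yields at once disjointness of different cells
  and injectivity of the indexing.\<close>

lemma cell_inject:
  assumes a: "0 \<le> a" "a < int n" and a': "0 \<le> a'" "a' < int n"
    and meet: "cell n b a \<inter> cell n b' a' \<noteq> {}"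
  shows "b = b' \<and> a = a'"
proof -
  from meet obtain x y where x: "x \<in> (if b then {of_int a <..< of_int a + 1} else {of_int a :: real})"
    and y: "y \<in> (if b' then {of_int a' <..< of_int a' + 1} else {of_int a' :: real})"
    and "to_circle n x = to_circle n y"
    unfolding cell_def by blast
  then obtain m :: int where m: "x = y + of_int m * of_nat n"
    unfolding to_circle_eq_iff by (auto simp: algebra_simps)
  \<comment> \<open>A point and an open interval with index \<open>a\<close> both lie in the
    half-open interval from \<open>a\<close> to \<open>a + 1\<close>, so the floor recovers
    \<open>a\<close> whatever \<open>b\<close> is.\<close>
  have fx: "\<lfloor>x\<rfloor> = a"
    using x by (auto split: if_splits simp: floor_eq_iff)
  have fy: "\<lfloor>y\<rfloor> = a'"
    using y by (auto split: if_splits simp: floor_eq_iff)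
  have "x = y + of_int (m * int n)"
    using m by simp
  then have "a = a' + m * int n"
    using fx fy by (metis floor_add_int)
  then have "a mod int n = a' mod int n"
    by simp
  then have "a = a'"
    using a a' by simp
  then have "m * int n = 0"
    using \<open>a = a' + m * int n\<close> by simp
  then have "x = y"
    using \<open>x = y + of_int (m * int n)\<close> by simp
  \<comment> \<open>The common real equals \<open>of_int a\<close> for a point and exceeds it for an
    interval, so it decides the kind.\<close>
  then have "b = b'"
    using x y \<open>a = a'\<close> by (auto split: if_splits)
  with \<open>a = a'\<close> show ?thesis
    by simp
qed

lemma cell_range:
  assumes "n \<ge> 1"
  shows "range (cell n b) = cell n b ` {0..<int n}"
proof -
  have "cell n b a \<in> cell n b ` {0..<int n}" for a
    using assms by (auto simp: image_iff intro!: bexI[of _ "a mod int n"] simp: cell_mod)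
  then show ?thesis
    by auto
qed

lemma point_factors_eq: "point_factors n = range (cell n False)"
  by (auto simp: point_factors_def cell_def)

lemma interval_factors_eq: "interval_factors n = range (cell n True)"
  by (auto simp: interval_factors_def cell_def)

lemma card_range_cell:
  assumes "n \<ge> 1"
  shows "card (range (cell n b)) = n"
proof -
  have "inj_on (cell n b) {0..<int n}"
    using cell_inject[of _ n _ b b] cell_nonempty[of n b] by (auto intro!: inj_onI)
  then show ?thesis
    using assms by (simp add: cell_range card_image)
qed

lemma finite_range_cell:
  assumes "n \<ge> 1"
  shows "finite (range (cell n b))"
  using assms by (simp add: cell_range)

text \<open>A factor of both kinds would be one nonempty cell carrying two different values of
  \<open>b\<close>, against \<open>cell_inject\<close>.\<close>

lemma factors_disjoint:
  assumes "n \<ge> 1"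
  shows "point_factors n \<inter> interval_factors n = {}"
proof (rule ccontr)
  assume "\<not> ?thesis"
  then obtain F where "F \<in> cell n False ` {0..<int n}" "F \<in> cell n True ` {0..<int n}"
    unfolding point_factors_eq interval_factors_eq cell_range[OF assms] by blast
  then obtain a a' where "a \<in> {0..<int n}" "a' \<in> {0..<int n}" "cell n False a = cell n True a'"
    by auto
  then show False
    using cell_inject[of a n a' False True] cell_nonempty[of n True a'] by auto
qed

lemma factor_cases:
  assumes "n \<ge> 1" "F \<in> point_factors n \<union> interval_factors n"
  obtains b a where "0 \<le> a" "a < int n" "F = cell n b a"
  using assms unfolding point_factors_eq interval_factors_eq by (auto simp: cell_range)

lemma factor_nonempty:
  assumes "F \<in> point_factors n \<union> interval_factors n"
  shows "F \<noteq> {}"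
  using assms cell_nonempty unfolding point_factors_eq interval_factors_eq by blast

lemma factor_eqI:
  assumes "n \<ge> 1"
    and "F \<in> point_factors n \<union> interval_factors n"
    and "G \<in> point_factors n \<union> interval_factors n"
    and "F \<inter> G \<noteq> {}"
  shows "F = G"
proof -
  obtain b a b' a' where "0 \<le> a" "a < int n" "F = cell n b a" "0 \<le> a'" "a' < int n" "G = cell n b' a'"
    using factor_cases[OF assms(1,2)] factor_cases[OF assms(1,3)] by metis
  then show ?thesis
    using assms(4) cell_inject[of a n a' b b'] by blast
qed

section \<open>The open cubes\<close>

text \<open>The family \<open>F\<close> in \<open>open_cubes\<close> is arbitrary outside
  \<open>{..<d}\<close>. Extensional families remove this freedom and leave one code per cube, which
  makes counting possible.\<close>

definition cube_codes :: "nat \<Rightarrow> nat \<Rightarrow> nat \<Rightarrow> (nat \<Rightarrow> real set set) set" where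
  "cube_codes n d i = {F \<in> {..<d} \<rightarrow>\<^sub>E point_factors n \<union> interval_factors n.
     card {j. j < d \<and> F j \<in> interval_factors n} = i}"

lemma open_cubes_eq: "open_cubes n d i = PiE {..<d} ` cube_codes n d i"
proof (intro equalityI subsetI)
  fix c assume "c \<in> open_cubes n d i"
  then obtain F where c: "c = PiE {..<d} F"
    and F: "\<forall>j<d. F j \<in> point_factors n \<union> interval_factors n"
    and i: "card {j. j < d \<and> F j \<in> interval_factors n} = i"
    unfolding open_cubes_def by auto
  have "{j. j < d \<and> restrict F {..<d} j \<in> interval_factors n} =
      {j. j < d \<and> F j \<in> interval_factors n}"
    by auto
  then have "restrict F {..<d} \<in> cube_codes n d i"
    using F i by (simp add: cube_codes_def)
  moreover have "c = PiE {..<d} (restrict F {..<d})"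
    unfolding c by (intro PiE_cong) simp
  ultimately show "c \<in> PiE {..<d} ` cube_codes n d i"
    by blast
next
  fix c assume "c \<in> PiE {..<d} ` cube_codes n d i"
  then show "c \<in> open_cubes n d i"
    unfolding open_cubes_def cube_codes_def by (auto simp: PiE_iff)
qed

text \<open>The intersection of two products is the product of the intersections; if it is nonempty,
  the factors meet in every coordinate and hence agree there.\<close>

lemma code_eqI:
  assumes "n \<ge> 1" "F \<in> cube_codes n d i" "G \<in> cube_codes n d i'"
    and meet: "PiE {..<d} F \<inter> PiE {..<d} G \<noteq> {}"
  shows "F = G"
proof (rule PiE_ext)
  show "F \<in> {..<d} \<rightarrow>\<^sub>E point_factors n \<union> interval_factors n"
    "G \<in> {..<d} \<rightarrow>\<^sub>E point_factors n \<union> interval_factors n"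
    using assms unfolding cube_codes_def by auto
  then show "F j = G j" if "j \<in> {..<d}" for j
    using that meet by (intro factor_eqI[OF \<open>n \<ge> 1\<close>]) (auto simp: PiE_Int PiE_eq_empty_iff)
qed

lemma open_cube_nonempty:
  assumes "c \<in> open_cubes n d i"
  shows "c \<noteq> {}"
  using assms factor_nonempty unfolding open_cubes_def
  by (smt (verit) PiE_eq_empty_iff lessThan_iff mem_Collect_eq)

text \<open>Cubes that meet share a code, and the code fixes the number of interval factors. So no
  cube is counted in two dimensions.\<close>

lemma open_cube_eqI:
  assumes "n \<ge> 1" "c \<in> open_cubes n d i" "c' \<in> open_cubes n d i'" "c \<inter> c' \<noteq> {}"
  shows "c = c' \<and> i = i'"
proof -
  from assms obtain F G where F: "F \<in> cube_codes n d i" "c = PiE {..<d} F"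
    and G: "G \<in> cube_codes n d i'" "c' = PiE {..<d} G"
    unfolding open_cubes_eq by auto
  then have "F = G"
    using assms code_eqI by blast
  with F G show ?thesis
    by (auto simp: cube_codes_def)
qed

text \<open>Choose the \<open>i\<close> coordinates that carry intervals; each coordinate then has
  \<open>n\<close> possible factors, whichever its kind.\<close>

lemma card_cube_codes:
  assumes "n \<ge> 1"
  shows "finite (cube_codes n d i)" "card (cube_codes n d i) = (d choose i) * n ^ d"
proof -
  define P I where "P = point_factors n" and "I = interval_factors n"
  have fin: "finite P" "finite I" and card: "card P = n" "card I = n"
    unfolding P_def I_def point_factors_eq interval_factors_eq
    using assms by (simp_all add: finite_range_cell card_range_cell)
  have PI: "P \<inter> I = {}"
    unfolding P_def I_def by (rule factors_disjoint[OF assms])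
  define B where "B S = (\<Pi>\<^sub>E j\<in>{..<d}. if j \<in> S then I else P)" for S
  define SS where "SS = {S. S \<subseteq> {..<d} \<and> card S = i}"
  \<comment> \<open>Since \<open>P\<close> and \<open>I\<close> are disjoint, \<open>F\<close>
    determines \<open>S\<close>. This gives both the interval count of a code in \<open>B S\<close>
    and the disjointness of the blocks.\<close>
  have B: "S = {j. j < d \<and> F j \<in> I}" if "F \<in> B S" "S \<in> SS" for F S
    using that PI unfolding B_def SS_def by (fastforce simp: PiE_iff split: if_splits)
  have eq: "cube_codes n d i = (\<Union>S\<in>SS. B S)"
  proof (intro equalityI subsetI)
    fix F assume F: "F \<in> cube_codes n d i"
    then have "F \<in> B {j. j < d \<and> F j \<in> I}" "{j. j < d \<and> F j \<in> I} \<in> SS"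
      unfolding cube_codes_def B_def SS_def P_def I_def by (auto simp: PiE_iff)
    then show "F \<in> (\<Union>S\<in>SS. B S)"
      by blast
  next
    fix F assume "F \<in> (\<Union>S\<in>SS. B S)"
    then obtain S where S: "S \<in> SS" "F \<in> B S"
      by auto
    then have "card {j. j < d \<and> F j \<in> I} = i"
      using B[OF S(2,1)] unfolding SS_def by auto
    moreover have "F \<in> {..<d} \<rightarrow>\<^sub>E P \<union> I"
      using S unfolding B_def by (auto simp: PiE_iff split: if_splits)
    ultimately show "F \<in> cube_codes n d i"
      unfolding cube_codes_def P_def I_def by simp
  qed
  have finB: "finite (B S)" for S
    unfolding B_def using fin by (intro finite_PiE) auto
  have cardB: "card (B S) = n ^ d" for S
    unfolding B_def by (simp add: card_PiE if_distrib card cong: if_cong)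
  have finS: "finite SS"
    unfolding SS_def by simp
  have cardS: "card SS = d choose i"
    unfolding SS_def using n_subsets[of "{..<d}" i] by simp
  show "finite (cube_codes n d i)"
    unfolding eq using finS finB by simp
  have "card (\<Union>S\<in>SS. B S) = (\<Sum>S\<in>SS. card (B S))"
    by (rule card_UN_disjoint) (use finS finB B in blast)+
  then show "card (cube_codes n d i) = (d choose i) * n ^ d"
    by (simp add: eq cardB cardS)
qed

lemma finite_open_cubes: "n \<ge> 1 \<Longrightarrow> finite (open_cubes n d i)"
  by (simp add: open_cubes_eq card_cube_codes)

lemma card_open_cubes:
  assumes "n \<ge> 1"
  shows "card (open_cubes n d i) = (d choose i) * n ^ d"
proof -
  \<comment> \<open>Nonemptiness makes two equal products meet, which is what
    \<open>code_eqI\<close> requires for injectivity.\<close>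
  have "PiE {..<d} F \<noteq> {}" if "F \<in> cube_codes n d i" for F
    using that open_cube_nonempty[of "PiE {..<d} F" n d i] by (auto simp: open_cubes_eq)
  then have "inj_on (PiE {..<d}) (cube_codes n d i)"
    by (intro inj_onI code_eqI[OF assms]) auto
  then show ?thesis
    by (simp add: open_cubes_eq card_image card_cube_codes[OF assms])
qed

text \<open>Any point of \<open>c\<close> lies in some member of \<open>X\<close>; that member meets
  \<open>c\<close> and so equals it. Geometric containment thereby becomes membership, which is what
  the inclusion events describe.\<close>

lemma open_cube_subset_Union_iff:
  assumes "n \<ge> 1" "c \<in> open_cubes n d i" "X \<subseteq> lattice_cubes n d"
  shows "c \<subseteq> \<Union>X \<longleftrightarrow> c \<in> X"
proof
  assume "c \<subseteq> \<Union>X"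
  moreover obtain x where "x \<in> c"
    using open_cube_nonempty[OF assms(2)] by blast
  ultimately obtain c' where c': "c' \<in> X" "x \<in> c'"
    by blast
  then obtain i' where "c' \<in> open_cubes n d i'"
    using assms(3) unfolding lattice_cubes_def by blast
  then have "c = c'"
    using open_cube_eqI[OF assms(1,2)] c' \<open>x \<in> c\<close> by blast
  with c' show "c \<in> X"
    by simp
qed blast

section \<open>Sums over the cubes\<close>

text \<open>The mean is linear. Expanding the square of the centered sum leaves only diagonal terms,
  because pairwise independence makes the covariances vanish.\<close>

lemma (in prob_space)
  fixes w :: "'i \<Rightarrow> real"
  assumes "finite I"
    and ev: "\<And>a. a \<in> I \<Longrightarrow> A a \<in> events"
  shows expectation_sum_indicator:
      "expectation (\<lambda>\<omega>. \<Sum>a\<in>I. w a * indicator (A a) \<omega>) = (\<Sum>a\<in>I. w a * prob (A a))"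
    and variance_sum_indicator_pairwise_indep:
      "(\<And>a b. a \<in> I \<Longrightarrow> b \<in> I \<Longrightarrow> a \<noteq> b \<Longrightarrow> prob (A a \<inter> A b) = prob (A a) * prob (A b)) \<Longrightarrow>
       variance (\<lambda>\<omega>. \<Sum>a\<in>I. w a * indicator (A a) \<omega>) =
         (\<Sum>a\<in>I. (w a)\<^sup>2 * (prob (A a) - (prob (A a))\<^sup>2))"
proof -
  have int: "integrable M (indicator (A a) :: _ \<Rightarrow> real)" if "a \<in> I" for a
    using ev[OF that] by (simp add: emeasure_eq_measure)
  show E: "expectation (\<lambda>\<omega>. \<Sum>a\<in>I. w a * indicator (A a) \<omega>) = (\<Sum>a\<in>I. w a * prob (A a))"
    using int ev by (subst Bochner_Integration.integral_sum) (auto intro!: sum.cong)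
  assume indep: "\<And>a b. a \<in> I \<Longrightarrow> b \<in> I \<Longrightarrow> a \<noteq> b \<Longrightarrow> prob (A a \<inter> A b) = prob (A a) * prob (A b)"
  define Y where "Y a \<omega> = indicator (A a) \<omega> - prob (A a)" for a \<omega>
  \<comment> \<open>The product of two indicators is the indicator of the intersection, so
    \<open>Y a * Y b\<close> becomes linear in indicators and can be integrated termwise.\<close>
  have YY: "(\<lambda>\<omega>. Y a \<omega> * Y b \<omega>) = (\<lambda>\<omega>. indicator (A a \<inter> A b) \<omega> - prob (A b) * indicator (A a) \<omega>
      - prob (A a) * indicator (A b) \<omega> + prob (A a) * prob (A b))" for a b
    by (auto simp: Y_def algebra_simps indicator_def)
  have int2: "integrable M (indicator (A a \<inter> A b) :: _ \<Rightarrow> real)" if "a \<in> I" "b \<in> I" for a b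
    using ev that by (simp add: emeasure_eq_measure)
  have intY: "integrable M (\<lambda>\<omega>. Y a \<omega> * Y b \<omega>)" if "a \<in> I" "b \<in> I" for a b
    unfolding YY using int int2 that by simp
  have "expectation (\<lambda>\<omega>. Y a \<omega> * Y b \<omega>) = prob (A a \<inter> A b) - prob (A a) * prob (A b)"
    if "a \<in> I" "b \<in> I" for a b
    unfolding YY using int int2 ev that by (simp add: prob_space)
  \<comment> \<open>On the diagonal \<open>A a \<inter> A a\<close> is \<open>A a\<close>, which
    gives the Bernoulli variance; off it \<open>indep\<close> gives zero.\<close>
  then have EY: "expectation (\<lambda>\<omega>. Y a \<omega> * Y b \<omega>) =
      (if a = b then prob (A a) - (prob (A a))\<^sup>2 else 0)" if "a \<in> I" "b \<in> I" for a b
    using indep that by (simp add: power2_eq_square)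
  have "(\<lambda>\<omega>. ((\<Sum>a\<in>I. w a * indicator (A a) \<omega>) - (\<Sum>a\<in>I. w a * prob (A a)))\<^sup>2) =
      (\<lambda>\<omega>. \<Sum>a\<in>I. \<Sum>b\<in>I. w a * w b * (Y a \<omega> * Y b \<omega>))"
    unfolding Y_def
    by (simp add: sum_subtractf[symmetric] right_diff_distrib[symmetric] power2_eq_square sum_product
        mult_ac)
  then have "variance (\<lambda>\<omega>. \<Sum>a\<in>I. w a * indicator (A a) \<omega>) =
      expectation (\<lambda>\<omega>. \<Sum>a\<in>I. \<Sum>b\<in>I. w a * w b * (Y a \<omega> * Y b \<omega>))"
    unfolding E by simp
  also have "\<dots> = (\<Sum>a\<in>I. \<Sum>b\<in>I. w a * w b * expectation (\<lambda>\<omega>. Y a \<omega> * Y b \<omega>))"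
    using intY by (simp add: Bochner_Integration.integral_sum)
  also have "\<dots> = (\<Sum>a\<in>I. \<Sum>b\<in>I. if a = b then (w a)\<^sup>2 * (prob (A a) - (prob (A a))\<^sup>2) else 0)"
    by (intro sum.cong refl) (simp add: EY power2_eq_square)
  also have "\<dots> = (\<Sum>a\<in>I. (w a)\<^sup>2 * (prob (A a) - (prob (A a))\<^sup>2))"
    using \<open>finite I\<close> by simp
  finally show "variance (\<lambda>\<omega>. \<Sum>a\<in>I. w a * indicator (A a) \<omega>) =
      (\<Sum>a\<in>I. (w a)\<^sup>2 * (prob (A a) - (prob (A a))\<^sup>2))" .
qed

lemma (in prob_space) indep_events_prob_Int:
  assumes "indep_events A I" "a \<in> I" "b \<in> I" "a \<noteq> b"
  shows "prob (A a \<inter> A b) = prob (A a) * prob (A b)"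
proof -
  have "prob (\<Inter>j\<in>{a, b}. A j) = (\<Prod>j\<in>{a, b}. prob (A j))"
    using assms(1) unfolding indep_events_def
    by (elim conjE allE[of _ "{a, b}"]) (use assms(2,3) in simp)
  with assms show ?thesis
    by simp
qed

text \<open>Terms with \<open>i < k\<close> vanish. Trinomial revision pulls
  \<open>d choose k\<close> out of the rest, and the shift \<open>j = i - k\<close> leaves the
  binomial expansion of \<open>(1 - p) ^ (d - k)\<close>.\<close>

lemma sum_binomial_intrinsic_volume:
  assumes "k \<le> d"
  shows "(\<Sum>i\<le>d. real (d choose i) * cube_intrinsic_volume k i * p ^ i) =
    real (d choose k) * p ^ k * (1 - p) ^ (d - k)"
proof -
  have "(\<Sum>i\<le>d. real (d choose i) * cube_intrinsic_volume k i * p ^ i) =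
      (\<Sum>i\<in>{k..d}. real (d choose i) * cube_intrinsic_volume k i * p ^ i)"
    by (rule sum.mono_neutral_right) (auto simp: cube_intrinsic_volume_def)
  also have "\<dots> = (\<Sum>i\<in>{k..d}. real ((d choose k) * ((d - k) choose (i - k))) * (-1) ^ (i - k) * p ^ i)"
    unfolding cube_intrinsic_volume_def
    by (intro sum.cong refl) (simp add: choose_mult[symmetric])
  also have "\<dots> = (\<Sum>j\<le>d - k. real (d choose k) * p ^ k * (real ((d - k) choose j) * (-p) ^ j))"
    using assms
    by (intro sum.reindex_bij_witness[of _ "\<lambda>j. j + k" "\<lambda>i. i - k"])
      (auto simp: power_add[symmetric] power_minus[of p])
  also have "\<dots> = real (d choose k) * p ^ k * (1 - p) ^ (d - k)"
    using binomial_ring[of "- p" 1 "d - k"] by (simp add: sum_distrib_left)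
  finally show ?thesis .
qed

section \<open>Mean and variance of the intrinsic volumes of the random set\<close>

theorem proposition12:
  fixes d n k :: nat and p :: real
    and M :: "'w measure"
    and A :: "(nat \<Rightarrow> real set) set \<Rightarrow> 'w set"
    and C :: "'w \<Rightarrow> (nat \<Rightarrow> real set) set"
  assumes "n \<ge> 2" and "k \<le> d" and "0 \<le> p" and "p \<le> 1"
    and "prob_space M"
    and "prob_space.indep_events M A (lattice_cubes n d)"
    and "\<And>i c. i \<le> d \<Longrightarrow> c \<in> open_cubes n d i \<Longrightarrow> measure M (A c) = p ^ i"
    and "\<And>\<omega>. \<omega> \<in> space M \<Longrightarrow> C \<omega> = \<Union>{c \<in> lattice_cubes n d. \<omega> \<in> A c}"
  shows "1 / real n ^ d * prob_space.expectation M (\<lambda>\<omega>. intrinsic_volume n d k (C \<omega>))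
           = real (d choose k) * p ^ k * (1 - p) ^ (d - k)
       \<and> 1 / real n ^ d * prob_space.variance M (\<lambda>\<omega>. intrinsic_volume n d k (C \<omega>))
           = (\<Sum>i=k..d. real (d choose i) * real (i choose k) ^ 2 * (p ^ i - p ^ (2 * i)))"
proof -
  interpret prob_space M by fact
  have n: "n \<ge> 1"
    using \<open>n \<ge> 2\<close> by simp
  define v where "v = cube_intrinsic_volume k"
  \<comment> \<open>Indexing by pairs keeps the dimension available as \<open>fst a\<close> beside
    the cube \<open>snd a\<close>.\<close>
  define I where "I = (SIGMA i:{..d}. open_cubes n d i)"
  define X where "X \<omega> = (\<Sum>a\<in>I. v (fst a) * indicator (A (snd a)) \<omega>)" for \<omega>
  have finI: "finite I"
    unfolding I_def using finite_open_cubes[OF n] by simp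
  have sumI: "(\<Sum>a\<in>I. f (fst a)) = real n ^ d * (\<Sum>i\<le>d. real (d choose i) * f i)"
    for f :: "nat \<Rightarrow> real"
  proof -
    have "(\<Sum>a\<in>I. f (fst a)) = (\<Sum>i\<le>d. \<Sum>c\<in>open_cubes n d i. f i)"
      unfolding I_def using finite_open_cubes[OF n]
      by (subst sum.Sigma) (auto simp: case_prod_beta)
    then show ?thesis
      by (simp add: card_open_cubes[OF n] sum_distrib_left mult_ac)
  qed
  have lat: "snd a \<in> lattice_cubes n d" if "a \<in> I" for a
    using that by (auto simp: I_def lattice_cubes_def)
  have ev: "A (snd a) \<in> events" if "a \<in> I" for a
    using assms(6) lat[OF that] unfolding indep_events_def by auto
  have P: "prob (A (snd a)) = p ^ fst a" if "a \<in> I" for a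
    using that assms(7) by (auto simp: I_def)
  have indep: "prob (A (snd a) \<inter> A (snd b)) = prob (A (snd a)) * prob (A (snd b))"
    if "a \<in> I" "b \<in> I" "a \<noteq> b" for a b
  proof (rule indep_events_prob_Int[OF assms(6) lat[OF that(1)] lat[OF that(2)]])
    \<comment> \<open>Independence is indexed by cubes, not pairs: equal nonempty cubes would force
      equal dimensions and hence equal pairs.\<close>
    show "snd a \<noteq> snd b"
      using that open_cube_eqI[OF n, of "snd a" d "fst a" "snd b" "fst b"]
        open_cube_nonempty[of "snd a" n d "fst a"]
      unfolding I_def by (auto simp: prod_eq_iff)
  qed
  \<comment> \<open>\<open>C\<close> is prescribed only on \<open>space M\<close>; equality there
    suffices for the integrals.\<close>
  have X: "intrinsic_volume n d k (C \<omega>) = X \<omega>" if "\<omega> \<in> space M" for \<omega>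
  proof -
    have sub: "c \<subseteq> C \<omega> \<longleftrightarrow> \<omega> \<in> A c" if "i \<le> d" "c \<in> open_cubes n d i" for i c
      unfolding assms(8)[OF \<open>\<omega> \<in> space M\<close>]
      using that by (subst open_cube_subset_Union_iff[OF n]) (auto simp: lattice_cubes_def)
    have "intrinsic_volume n d k (C \<omega>) = (\<Sum>i\<le>d. \<Sum>c\<in>open_cubes n d i. v i * indicator (A c) \<omega>)"
      unfolding intrinsic_volume_def v_def
      using finite_open_cubes[OF n]
      by (intro sum.cong refl sum.mono_neutral_cong_left) (auto simp: sub)
    also have "\<dots> = X \<omega>"
      unfolding X_def I_def using finite_open_cubes[OF n]
      by (subst sum.Sigma) (auto simp: case_prod_beta)
    finally show ?thesis .
  qed
  have E: "expectation (\<lambda>\<omega>. intrinsic_volume n d k (C \<omega>)) = expectation X"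
    by (intro Bochner_Integration.integral_cong refl X)
  have V: "variance (\<lambda>\<omega>. intrinsic_volume n d k (C \<omega>)) = variance X"
    unfolding E by (intro Bochner_Integration.integral_cong refl) (simp add: X)
  have "expectation X = (\<Sum>a\<in>I. v (fst a) * p ^ fst a)"
    unfolding X_def by (simp add: expectation_sum_indicator[OF finI ev] P)
  also have "\<dots> = real n ^ d * (real (d choose k) * p ^ k * (1 - p) ^ (d - k))"
    using sumI[of "\<lambda>i. v i * p ^ i"] sum_binomial_intrinsic_volume[OF \<open>k \<le> d\<close>, of p]
    by (simp add: v_def mult.assoc)
  finally have exp_X: "expectation X = \<dots>" .
  have "variance X = (\<Sum>a\<in>I. (v (fst a))\<^sup>2 * (p ^ fst a - (p ^ fst a)\<^sup>2))"
    unfolding X_def by (subst variance_sum_indicator_pairwise_indep[OF finI ev indep]) (simp_all add: P)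
  also have "\<dots> = real n ^ d * (\<Sum>i\<le>d. real (d choose i) * ((v i)\<^sup>2 * (p ^ i - (p ^ i)\<^sup>2)))"
    using sumI[of "\<lambda>i. (v i)\<^sup>2 * (p ^ i - (p ^ i)\<^sup>2)"] .
  \<comment> \<open>Squaring removes the sign in \<open>v i\<close>, and the binomial coefficient
    kills the terms with \<open>i < k\<close>.\<close>
  also have "(\<Sum>i\<le>d. real (d choose i) * ((v i)\<^sup>2 * (p ^ i - (p ^ i)\<^sup>2))) =
      (\<Sum>i=k..d. real (d choose i) * real (i choose k) ^ 2 * (p ^ i - p ^ (2 * i)))"
    by (rule sum.mono_neutral_cong_right)
      (auto simp: v_def cube_intrinsic_volume_def power_mult_distrib power_mult[symmetric] mult_ac)
  finally have var_X: "variance X = real n ^ d * \<dots>" .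
  show ?thesis
    unfolding V var_X unfolding E exp_X using n by simp
qed

end
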